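(* Let $\Phi:\mathbb{M}(n)\to\mathbb{M}(k)$ be a positive unital linear map. Let $A\in\mathbb{M}(n)$ be a Hermitian matrix whose spectrum is contained in the real interval $[m,M]$. Then for every $r=0,1,2,\ldots$, $$\left[\Phi(A^{i+j-1})-m\,\Phi(A^{i+j-2})\right]_{1\le i,j\le r+1}\ge O$$ and $$\left[M\,\Phi(A^{i+j-2})-\Phi(A^{i+j-1})\right]_{1\le i,j\le r+1}\ge O.$$
   Context: $\mathbb{M}(n)$ is the $C^*$-algebra of all $n\times n$ complex matrices. A linear map $\Phi:\mathbb{M}(n)\to\mathbb{M}(k)$ is positive if it sends positive semidefinite matrices to positive semidefinite matrices, and unital if $\Phi(I)=I$. $[X_{ij}]_{1\le i,j\le r+1}$ with $X_{ij}\in\mathbb{M}(k)$ denotes the $(r+1)\times(r+1)$ block matrix with blocks $X_{ij}$, viewed as an element of $\mathbb{M}((r+1)k)$. $X\ge O$ means $X$ is Hermitian positive semidefinite. $A^0=I$. *)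

theory Defs
  imports
    "Jordan_Normal_Form.Schur_Decomposition"
    "Jordan_Normal_Form.Spectral_Radius"
begin

definition hermitian_mat :: "complex mat \<Rightarrow> bool" where
  "hermitian_mat A \<longleftrightarrow> square_mat A \<and> mat_adjoint A = A"

definition psd_mat :: "complex mat \<Rightarrow> bool" where
  "psd_mat A \<longleftrightarrow> hermitian_mat A \<and>
     (\<forall>v \<in> carrier_vec (dim_row A). 0 \<le> Re ((A *\<^sub>v v) \<bullet>c v))"

text \<open>Matrices of all sizes share one type, so a map from n-by-n to k-by-k matrices is a
  function constrained on the carrier only; its values elsewhere are irrelevant.\<close>

definition linear_mat_map :: "nat \<Rightarrow> nat \<Rightarrow> (complex mat \<Rightarrow> complex mat) \<Rightarrow> bool" where
  "linear_mat_map n k \<Phi> \<longleftrightarrow>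
     \<Phi> \<in> carrier_mat n n \<rightarrow> carrier_mat k k \<and>
     (\<forall>X \<in> carrier_mat n n. \<forall>Y \<in> carrier_mat n n. \<Phi> (X + Y) = \<Phi> X + \<Phi> Y) \<and>
     (\<forall>c. \<forall>X \<in> carrier_mat n n. \<Phi> (c \<cdot>\<^sub>m X) = c \<cdot>\<^sub>m \<Phi> X)"

definition positive_mat_map :: "nat \<Rightarrow> (complex mat \<Rightarrow> complex mat) \<Rightarrow> bool" where
  "positive_mat_map n \<Phi> \<longleftrightarrow> (\<forall>X \<in> carrier_mat n n. psd_mat X \<longrightarrow> psd_mat (\<Phi> X))"

definition unital_mat_map :: "nat \<Rightarrow> nat \<Rightarrow> (complex mat \<Rightarrow> complex mat) \<Rightarrow> bool" where
  "unital_mat_map n k \<Phi> \<longleftrightarrow> \<Phi> (1\<^sub>m n) = 1\<^sub>m k"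

text \<open>The s-by-s block matrix with k-by-k blocks \<open>X i j\<close>. Blocks are numbered from 1 (as in
  \<open>1 \<le> i, j \<le> s\<close>), whereas matrix entries are numbered from 0.\<close>

definition block_mat :: "nat \<Rightarrow> nat \<Rightarrow> (nat \<Rightarrow> nat \<Rightarrow> complex mat) \<Rightarrow> complex mat" where
  "block_mat s k X = mat (s * k) (s * k)
     (\<lambda>(p, q). X (p div k + 1) (q div k + 1) $$ (p mod k, q mod k))"

end

(* Diagonalise A = \<Sum>l. \<mu> l u_l u_l^* with unit eigenvectors u_l. By linearity
   \<Phi>(A^p) = \<Sum>l. \<mu> l ^ p W_l, where W_l = \<Phi>(u_l u_l^* ) is positive semidefinite. With
   y_l = \<Sum>i. \<mu> l ^ i x_i, the quadratic form of the first block matrix at x = (x_0, ..., x_r) is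
   \<Sum>l. (\<mu> l - m) <W_l y_l, y_l>, which is nonnegative; the second one has weights M - \<mu> l. *)
theory Submission
  imports Defs
begin

section \<open>Hermitian and positive semidefinite matrices, entrywise\<close>

lemma hermitian_mat_iff:
  assumes "A \<in> carrier_mat n n"
  shows "hermitian_mat A \<longleftrightarrow> (\<forall>i<n. \<forall>j<n. A $$ (i, j) = cnj (A $$ (j, i)))"
proof -
  have adj: "mat_adjoint A = mat n n (\<lambda>(i, j). cnj (A $$ (j, i)))"
    using assms by (intro eq_matI) (auto simp: mat_adjoint_def mat_of_rows_def)
  have "mat_adjoint A = A \<longleftrightarrow> (\<forall>i<n. \<forall>j<n. cnj (A $$ (j, i)) = A $$ (i, j))"
    unfolding adj mat_eq_iff using carrier_matD[OF assms] by (simp only: dim_row_mat dim_col_mat) simp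
  then show ?thesis
    unfolding hermitian_mat_def using assms by (simp add: eq_commute)
qed

lemma hermitian_mat_cnj_index:
  assumes "A \<in> carrier_mat n n" "hermitian_mat A" "i < n" "j < n"
  shows "cnj (A $$ (i, j)) = A $$ (j, i)"
proof -
  have "A $$ (j, i) = cnj (A $$ (i, j))"
    using assms iffD1[OF hermitian_mat_iff[OF assms(1)]] by blast
  then show ?thesis by (rule sym)
qed

lemma hermitian_matI:
  assumes "A \<in> carrier_mat n n"
    and "\<And>i j. i < n \<Longrightarrow> j < n \<Longrightarrow> A $$ (i, j) = cnj (A $$ (j, i))"
  shows "hermitian_mat A"
  using assms hermitian_mat_iff by blast

text \<open>Vectors become functions on the naturals, of which only the first \<open>n\<close>
  values enter. This frees the quadratic form of carrier conditions.\<close>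

lemma psd_mat_iff:
  assumes A: "A \<in> carrier_mat n n"
  shows "psd_mat A \<longleftrightarrow> hermitian_mat A \<and>
    (\<forall>x :: nat \<Rightarrow> complex. 0 \<le> Re (\<Sum>i<n. \<Sum>j<n. A $$ (i, j) * x j * cnj (x i)))"
proof -
  have form: "(A *\<^sub>v v) \<bullet>c v = (\<Sum>i<n. \<Sum>j<n. A $$ (i, j) * v $ j * cnj (v $ i))"
    if "v \<in> carrier_vec n" for v
    using A that
    by (auto simp: scalar_prod_def sum_distrib_right atLeast0LessThan intro!: sum.cong)
  have "(\<forall>v \<in> carrier_vec n. 0 \<le> Re ((A *\<^sub>v v) \<bullet>c v)) \<longleftrightarrow>
    (\<forall>x :: nat \<Rightarrow> complex. 0 \<le> Re (\<Sum>i<n. \<Sum>j<n. A $$ (i, j) * x j * cnj (x i)))"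
    (is "?L \<longleftrightarrow> ?R")
  proof
    assume ?L
    show ?R
    proof
      fix x :: "nat \<Rightarrow> complex"
      from \<open>?L\<close> have "0 \<le> Re ((A *\<^sub>v vec n x) \<bullet>c vec n x)" by simp
      then show "0 \<le> Re (\<Sum>i<n. \<Sum>j<n. A $$ (i, j) * x j * cnj (x i))"
        by (simp add: form)
    qed
  qed (simp add: form)
  then show ?thesis
    unfolding psd_mat_def using A by simp
qed

lemma index_mult_mat_sum:
  assumes "A \<in> carrier_mat p q" "B \<in> carrier_mat q s" "i < p" "j < s"
  shows "(A * B) $$ (i, j) = (\<Sum>l<q. A $$ (i, l) * B $$ (l, j))"
  using assms by (auto simp: scalar_prod_def atLeast0LessThan intro!: sum.cong)

text \<open>The adjoint of \<open>A * B\<close> is \<open>B * A\<close>, and commutation turns it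
  back into \<open>A * B\<close>.\<close>

lemma hermitian_mat_mult_commute:
  assumes A: "A \<in> carrier_mat n n" "hermitian_mat A"
    and B: "B \<in> carrier_mat n n" "hermitian_mat B"
    and AB: "A * B = B * A"
  shows "hermitian_mat (A * B)"
proof -
  have "(A * B) $$ (i, j) = cnj ((A * B) $$ (j, i))" if "i < n" "j < n" for i j
  proof -
    have "(A * B) $$ (i, j) = (\<Sum>l<n. B $$ (i, l) * A $$ (l, j))"
      unfolding AB using index_mult_mat_sum[OF B(1) A(1)] that by blast
    also have "\<dots> = (\<Sum>l<n. cnj (A $$ (j, l) * B $$ (l, i)))"
      using that
      by (intro sum.cong)
        (auto simp: hermitian_mat_cnj_index[OF A] hermitian_mat_cnj_index[OF B] mult.commute)
    also have "\<dots> = cnj ((A * B) $$ (j, i))"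
      using index_mult_mat_sum[OF A(1) B(1)] that by simp
    finally show ?thesis .
  qed
  then show ?thesis
    using A(1) B(1) hermitian_mat_iff mult_carrier_mat by metis
qed


section \<open>Spectral theorem for Hermitian matrices\<close>

text \<open>The trace serves twice: the trace of \<open>A * A\<close> detects a zero Hermitian
  matrix, and the trace of a projection bounds the number of eigenvectors still to be split
  off.\<close>

definition mat_trace :: "'a::comm_ring_1 mat \<Rightarrow> 'a" where
  "mat_trace A = (\<Sum>i<dim_row A. A $$ (i, i))"

lemma mat_trace_mult_commute:
  assumes "A \<in> carrier_mat n n" "B \<in> carrier_mat n n"
  shows "mat_trace (A * B) = mat_trace (B * A)"
proof -
  have "mat_trace (A * B) = (\<Sum>i<n. \<Sum>l<n. A $$ (i, l) * B $$ (l, i))"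
    using assms by (simp add: mat_trace_def index_mult_mat_sum[OF assms] del: index_mult_mat(1))
  also have "\<dots> = (\<Sum>l<n. \<Sum>i<n. B $$ (l, i) * A $$ (i, l))"
    by (subst sum.swap) (simp add: mult.commute)
  also have "\<dots> = mat_trace (B * A)"
    using assms by (simp add: mat_trace_def index_mult_mat_sum[OF assms(2,1)] del: index_mult_mat(1))
  finally show ?thesis .
qed

text \<open>Cyclicity of the trace moves \<open>P\<close> to the far end, where \<open>Q * P\<close>
  is the identity.\<close>

lemma mat_trace_similar:
  assumes "similar_mat_wit A B P Q"
  shows "mat_trace A = mat_trace B"
proof -
  obtain n where c: "A \<in> carrier_mat n n" "B \<in> carrier_mat n n" "P \<in> carrier_mat n n"
      "Q \<in> carrier_mat n n" and QP: "Q * P = 1\<^sub>m n" and A: "A = P * B * Q"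
    using assms unfolding similar_mat_wit_def Let_def by auto
  have "mat_trace A = mat_trace (P * (B * Q))"
    unfolding A using c by simp
  also have "\<dots> = mat_trace (B * Q * P)"
    using c by (intro mat_trace_mult_commute[of _ n]) auto
  also have "B * Q * P = B"
    using c QP by (simp add: assoc_mult_mat[of B n n Q n P n])
  finally show ?thesis .
qed

text \<open>Entry \<open>(j, i)\<close> is the conjugate of entry \<open>(i, j)\<close>, so the
  trace of the square is the squared Frobenius norm.\<close>

lemma hermitian_mat_trace_square:
  assumes A: "A \<in> carrier_mat n n" "hermitian_mat A"
  shows "mat_trace (A * A) = complex_of_real (\<Sum>i<n. \<Sum>j<n. (cmod (A $$ (i, j)))\<^sup>2)"
proof -
  have "mat_trace (A * A) = (\<Sum>i<n. \<Sum>j<n. A $$ (i, j) * A $$ (j, i))"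
    using A by (simp add: mat_trace_def index_mult_mat_sum[OF A(1) A(1)] del: index_mult_mat(1))
  also have "\<dots> = (\<Sum>i<n. \<Sum>j<n. complex_of_real ((cmod (A $$ (i, j)))\<^sup>2))"
  proof (intro sum.cong refl)
    fix i j assume "i \<in> {..<n}" "j \<in> {..<n}"
    then have "A $$ (j, i) = cnj (A $$ (i, j))"
      by (simp add: hermitian_mat_cnj_index[OF A])
    then show "A $$ (i, j) * A $$ (j, i) = complex_of_real ((cmod (A $$ (i, j)))\<^sup>2)"
      by (simp only: complex_norm_square)
  qed
  finally show ?thesis by simp
qed

text \<open>The Frobenius norm vanishes. The bound is an inequality so that it also fits a
  projection whose trace is only known to be at most 0.\<close>

lemma hermitian_mat_eq_0:
  assumes A: "A \<in> carrier_mat n n" "hermitian_mat A" and tr: "Re (mat_trace (A * A)) \<le> 0"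
  shows "A = 0\<^sub>m n n"
proof -
  have "(\<Sum>i<n. \<Sum>j<n. (cmod (A $$ (i, j)))\<^sup>2) = 0"
    using tr hermitian_mat_trace_square[OF A] by (simp add: antisym sum_nonneg)
  then have "\<forall>i<n. \<forall>j<n. A $$ (i, j) = 0"
    by (simp add: sum_nonneg_eq_0_iff sum_nonneg)
  then show ?thesis using A by auto
qed

text \<open>Otherwise a Schur form \<open>B\<close> is strictly triangular, so \<open>tr (A\<^sup>2) = tr (B\<^sup>2) = 0\<close>.\<close>
lemma hermitian_mat_nonzero_eigenvalue:
  assumes A: "A \<in> carrier_mat n n" "hermitian_mat A" and nz: "A \<noteq> 0\<^sub>m n n"
  obtains w \<mu> where "eigenvector A w \<mu>" "\<mu> \<noteq> 0"
proof (rule ccontr)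
  assume "\<not> thesis"
  then have ev0: "\<mu> = 0" if "eigenvalue A \<mu>" for \<mu>
    using that \<open>\<And>w \<mu>. eigenvector A w \<mu> \<Longrightarrow> \<mu> \<noteq> 0 \<Longrightarrow> thesis\<close> unfolding eigenvalue_def by blast
  obtain es where cp: "char_poly A = (\<Prod>a\<leftarrow>es. [:- a, 1:])"
    using char_poly_factorized[OF A(1)] by blast
  \<comment> \<open>The list \<open>es\<close>, which becomes the diagonal of the Schur form,
    consists of roots of the characteristic polynomial, hence of eigenvalues.\<close>
  have es0: "e = 0" if "e \<in> set es" for e
    using that
    by (intro ev0) (auto simp: eigenvalue_root_char_poly[OF A(1)] cp poly_prod_list prod_list_zero_iff)
  obtain B P Q where "schur_decomposition A es = (B, P, Q)"
    by (cases "schur_decomposition A es")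
  from schur_decomposition[OF A(1) cp this]
  have wit: "similar_mat_wit A B P Q" and ut: "upper_triangular B" and diag: "diag_mat B = es"
    by auto
  have B: "B \<in> carrier_mat n n"
    using wit A unfolding similar_mat_wit_def Let_def by auto
  have zero: "B $$ (i, j) = 0" if "i < n" "j \<le> i" for i j
  proof (cases "j = i")
    case True
    have "B $$ (i, i) \<in> set (diag_mat B)"
      using B that by (auto simp: diag_mat_def)
    then show ?thesis using True es0 diag by auto
  qed (use ut B that in \<open>auto simp: upper_triangular_def\<close>)
  have "mat_trace (A * A) = mat_trace (B * B)"
    using mat_trace_similar[OF similar_mat_wit_pow[OF wit, of 2]] A B
    by (simp add: numeral_2_eq_2)
  also have "\<dots> = (\<Sum>i<n. \<Sum>j<n. B $$ (i, j) * B $$ (j, i))"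
    using B by (simp add: mat_trace_def index_mult_mat_sum[OF B B] del: index_mult_mat(1))
  also have "\<dots> = 0"
  \<comment> \<open>One of the positions \<open>(i, j)\<close> and \<open>(j, i)\<close> lies on or
    below the diagonal, where \<open>B\<close> vanishes.\<close>
  proof (intro sum.neutral ballI)
    fix i j assume "i \<in> {..<n}" "j \<in> {..<n}"
    then show "B $$ (i, j) * B $$ (j, i) = 0"
      using zero[of i j] zero[of j i] by (cases "j \<le> i") auto
  qed
  finally show False
    using hermitian_mat_eq_0[OF A] nz by simp
qed

text \<open>Instead of restricting \<open>A\<close> to the range of \<open>E\<close>, one uses the
  Hermitian matrix \<open>A * E\<close> on the full space. If it is nonzero, its eigenvectors for
  nonzero eigenvalues lie in that range; if it is zero, \<open>A\<close> annihilates the whole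
  range.\<close>

lemma eigenvector_in_range:
  assumes A: "A \<in> carrier_mat n n" "hermitian_mat A"
    and E: "E \<in> carrier_mat n n" "hermitian_mat E" "E * E = E" "E \<noteq> 0\<^sub>m n n"
    and AE: "A * E = E * A"
  obtains w \<mu> where "eigenvector A w \<mu>" "E *\<^sub>v w = w"
proof (cases "A * E = 0\<^sub>m n n")
  case False
  have C: "A * E \<in> carrier_mat n n" "hermitian_mat (A * E)"
    using A E AE hermitian_mat_mult_commute by auto
  obtain w \<mu> where "eigenvector (A * E) w \<mu>" and \<mu>: "\<mu> \<noteq> 0"
    using hermitian_mat_nonzero_eigenvalue[OF C False] .
  then have w: "w \<in> carrier_vec n" "w \<noteq> 0\<^sub>v n" and AEw: "(A * E) *\<^sub>v w = \<mu> \<cdot>\<^sub>v w"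
    using A by (auto simp: eigenvector_def)
  \<comment> \<open>Since \<open>E * (A * E) = A * E\<close>, applying \<open>E\<close> to the
    eigenvalue equation leaves its right side unchanged; dividing by \<mu> then gives
    \<open>E *\<^sub>v w = w\<close>.\<close>
  have "\<mu> \<cdot>\<^sub>v (E *\<^sub>v w) = E *\<^sub>v ((A * E) *\<^sub>v w)"
    using E w AEw by (simp add: mult_mat_vec)
  also have "\<dots> = (E * (E * A)) *\<^sub>v w"
    unfolding AE using A E w by (intro assoc_mult_mat_vec[symmetric]) auto
  also have "E * (E * A) = A * E"
    using A E AE by (simp flip: assoc_mult_mat[of E n n E n A n])
  also have "(A * E) *\<^sub>v w = \<mu> \<cdot>\<^sub>v w" by (fact AEw)
  finally have "inverse \<mu> \<cdot>\<^sub>v (\<mu> \<cdot>\<^sub>v (E *\<^sub>v w)) = inverse \<mu> \<cdot>\<^sub>v (\<mu> \<cdot>\<^sub>v w)" by simp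
  then have Ew: "E *\<^sub>v w = w"
    using \<mu> by (simp add: smult_smult_assoc)
  then have "eigenvector A w \<mu>"
    using A E w AEw by (simp add: eigenvector_def)
  then show ?thesis using Ew that by blast
next
  case True
  obtain j where j: "j < n" "col E j \<noteq> 0\<^sub>v n"
  proof (rule ccontr)
    assume "\<not> thesis"
    then have "\<forall>j<n. col E j = 0\<^sub>v n" using that by blast
    then have "\<forall>i<n. \<forall>j<n. E $$ (i, j) = 0"
      using E(1) by (metis carrier_matD index_col index_zero_vec(1))
    then show False using E by auto
  qed
  \<comment> \<open>A column of \<open>E\<close> is fixed by \<open>E\<close> because
    \<open>E * E = E\<close>, and it is killed by \<open>A\<close> because \<open>A * E\<close> is
    zero.\<close>
  have "E *\<^sub>v col E j = col (E * E) j" "A *\<^sub>v col E j = col (A * E) j"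
    using A E(1) j by (auto intro!: eq_vecI)
  then have "E *\<^sub>v col E j = col E j" "A *\<^sub>v col E j = 0 \<cdot>\<^sub>v col E j"
    using E(1,3) True j by (auto intro!: eq_vecI)
  moreover have "eigenvector A (col E j) 0"
    using calculation A E(1) j by (auto simp: eigenvector_def)
  ultimately show ?thesis using that by blast
qed

section \<open>Rank-one matrices\<close>

text \<open>This is \<open>u v^*\<close>. The conjugate makes \<open>outer_prod u u\<close>
  Hermitian and, for a unit vector \<open>u\<close>, the orthogonal projection onto its
  span.\<close>

definition outer_prod :: "complex vec \<Rightarrow> complex vec \<Rightarrow> complex mat" where
  "outer_prod u v = mat (dim_vec u) (dim_vec v) (\<lambda>(i, j). u $ i * cnj (v $ j))"

lemma outer_prod_carrier [simp]:
  "u \<in> carrier_vec n \<Longrightarrow> v \<in> carrier_vec q \<Longrightarrow> outer_prod u v \<in> carrier_mat n q"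
  by (auto simp: outer_prod_def)

lemma index_outer_prod [simp]:
  "i < dim_vec u \<Longrightarrow> j < dim_vec v \<Longrightarrow> outer_prod u v $$ (i, j) = u $ i * cnj (v $ j)"
  by (simp add: outer_prod_def)

lemma mult_outer_prod:
  assumes "A \<in> carrier_mat n n" "u \<in> carrier_vec n" "v \<in> carrier_vec n"
  shows "A * outer_prod u v = outer_prod (A *\<^sub>v u) v"
proof (rule eq_matI)
  fix i j assume "i < dim_row (outer_prod (A *\<^sub>v u) v)" "j < dim_col (outer_prod (A *\<^sub>v u) v)"
  then have ij: "i < n" "j < n" using assms by (auto simp: outer_prod_def)
  have "(A * outer_prod u v) $$ (i, j) = (\<Sum>l<n. A $$ (i, l) * (u $ l * cnj (v $ j)))"
    using assms ij index_mult_mat_sum[OF assms(1) outer_prod_carrier[OF assms(2,3)] ij] by simp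
  also have "\<dots> = outer_prod (A *\<^sub>v u) v $$ (i, j)"
    using assms ij by (simp add: scalar_prod_def atLeast0LessThan sum_distrib_right mult.assoc)
  finally show "(A * outer_prod u v) $$ (i, j) = outer_prod (A *\<^sub>v u) v $$ (i, j)" .
qed (use assms in \<open>auto simp: outer_prod_def\<close>)

text \<open>In general \<open>u v^* A = u (A^* v)^*\<close>, and here
  \<open>A^* = A\<close>.\<close>

lemma outer_prod_mult_hermitian:
  assumes A: "A \<in> carrier_mat n n" "hermitian_mat A" and u: "u \<in> carrier_vec n" "v \<in> carrier_vec n"
  shows "outer_prod u v * A = outer_prod u (A *\<^sub>v v)"
proof (rule eq_matI)
  fix i j assume "i < dim_row (outer_prod u (A *\<^sub>v v))" "j < dim_col (outer_prod u (A *\<^sub>v v))"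
  then have ij: "i < n" "j < n" using A u by (auto simp: outer_prod_def)
  have "(outer_prod u v * A) $$ (i, j) = (\<Sum>l<n. u $ i * cnj (v $ l) * A $$ (l, j))"
    using A u ij index_mult_mat_sum[OF outer_prod_carrier[OF u] A(1) ij] by simp
  also have "\<dots> = (\<Sum>l<n. u $ i * cnj (A $$ (j, l) * v $ l))"
    using ij by (intro sum.cong) (auto simp: hermitian_mat_cnj_index[OF A])
  also have "\<dots> = outer_prod u (A *\<^sub>v v) $$ (i, j)"
    using A u ij by (simp add: scalar_prod_def atLeast0LessThan sum_distrib_left)
  finally show "(outer_prod u v * A) $$ (i, j) = outer_prod u (A *\<^sub>v v) $$ (i, j)" .
qed (use assms in \<open>auto simp: outer_prod_def\<close>)

lemma hermitian_outer_prod: "hermitian_mat (outer_prod u u)"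
proof -
  have "outer_prod u u \<in> carrier_mat (dim_vec u) (dim_vec u)"
    by (simp add: outer_prod_def)
  moreover have "outer_prod u u $$ (i, j) = cnj (outer_prod u u $$ (j, i))"
    if "i < dim_vec u" "j < dim_vec u" for i j
    using that by simp
  ultimately show ?thesis
    using hermitian_mat_iff by blast
qed

text \<open>The quadratic form at \<open>x\<close> factors as \<open>z * cnj z\<close>, where
  \<open>z\<close> is the inner product of \<open>u\<close> with \<open>x\<close>.\<close>

lemma psd_outer_prod: "psd_mat (outer_prod u u)"
proof -
  have "0 \<le> Re (\<Sum>i<dim_vec u. \<Sum>j<dim_vec u. outer_prod u u $$ (i, j) * x j * cnj (x i))" for x
  proof -
    define z where "z = (\<Sum>i<dim_vec u. u $ i * cnj (x i))"
    have "(\<Sum>i<dim_vec u. \<Sum>j<dim_vec u. outer_prod u u $$ (i, j) * x j * cnj (x i)) =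
        (\<Sum>i<dim_vec u. \<Sum>j<dim_vec u. (u $ i * cnj (x i)) * (cnj (u $ j) * x j))"
      by (intro sum.cong refl) simp
    also have "\<dots> = z * cnj z"
      by (simp add: z_def sum_product)
    finally show ?thesis
      by (simp only: complex_norm_square[symmetric] Re_complex_of_real zero_le_power2)
  qed
  then show ?thesis
    using psd_mat_iff[of "outer_prod u u" "dim_vec u"] hermitian_outer_prod by auto
qed

section \<open>Resolution of the identity by unit eigenvectors\<close>

text \<open>The normalised vector is given as an explicit multiple of \<open>w\<close>, so that
  linear properties of \<open>w\<close>, such as being fixed by a projection, pass to it.\<close>

lemma unit_eigenvector:
  assumes A: "A \<in> carrier_mat n n" and w: "eigenvector A w \<mu>"
  obtains c where "eigenvector A (c \<cdot>\<^sub>v w) \<mu>" "(\<Sum>i<n. (c \<cdot>\<^sub>v w) $ i * cnj ((c \<cdot>\<^sub>v w) $ i)) = 1"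
proof -
  define s where "s = (\<Sum>i<n. (cmod (w $ i))\<^sup>2)"
  have wc: "w \<in> carrier_vec n" and w0: "w \<noteq> 0\<^sub>v n" and Aw: "A *\<^sub>v w = \<mu> \<cdot>\<^sub>v w"
    using A w by (auto simp: eigenvector_def)
  have "s \<noteq> 0"
  proof
    assume "s = 0"
    then have "\<forall>i<n. w $ i = 0"
      by (simp add: s_def sum_nonneg_eq_0_iff)
    then show False using wc w0 by auto
  qed
  moreover have "0 \<le> s" by (simp add: s_def sum_nonneg)
  ultimately have s: "0 < s" by simp
  define c where "c = complex_of_real (1 / sqrt s)"
  have c: "c \<noteq> 0" "c * cnj c * complex_of_real s = 1"
    using s by (auto simp: c_def simp flip: of_real_mult)
  have "(\<Sum>i<n. (c \<cdot>\<^sub>v w) $ i * cnj ((c \<cdot>\<^sub>v w) $ i)) = (\<Sum>i<n. c * cnj c * (w $ i * cnj (w $ i)))"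
    using wc by (intro sum.cong) (auto simp: mult_ac)
  also have "\<dots> = c * cnj c * complex_of_real s"
    unfolding s_def of_real_sum complex_norm_square by (simp only: sum_distrib_left)
  also have "\<dots> = 1" by (fact c(2))
  finally have "(\<Sum>i<n. (c \<cdot>\<^sub>v w) $ i * cnj ((c \<cdot>\<^sub>v w) $ i)) = 1" .
  moreover have "c \<cdot>\<^sub>v w \<noteq> 0\<^sub>v n"
  proof
    assume "c \<cdot>\<^sub>v w = 0\<^sub>v n"
    then have "\<forall>i<n. c * w $ i = 0"
      using wc by (metis carrier_vecD index_smult_vec(1) index_zero_vec(1))
    then show False using c(1) wc w0 by auto
  qed
  then have "eigenvector A (c \<cdot>\<^sub>v w) \<mu>"
    using A wc Aw by (auto simp: eigenvector_def mult_mat_vec smult_smult_assoc mult.commute)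
  ultimately show ?thesis using that by blast
qed

text \<open>Splitting a unit eigenvector off the projection \<open>E\<close> lowers its trace by one.\<close>
lemma eigenvector_resolution_projection:
  assumes A: "A \<in> carrier_mat n n" "hermitian_mat A"
    and "E \<in> carrier_mat n n" "hermitian_mat E" "E * E = E" "A * E = E * A"
    and "Re (mat_trace E) \<le> real t"
  shows "\<exists>d u \<mu>. (\<forall>l<d. eigenvector A (u l) (\<mu> l)) \<and>
    (\<forall>i<n. \<forall>j<n. E $$ (i, j) = (\<Sum>l<d::nat. u l $ i * cnj (u l $ j)))"
  using assms(3-)
proof (induction t arbitrary: E)
  case 0
  \<comment> \<open>As \<open>E * E = E\<close>, the trace bound is one on the trace of
    \<open>E * E\<close>; the empty family then represents the zero matrix.\<close>
  then have "E = 0\<^sub>m n n"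
    using hermitian_mat_eq_0[of E n] by simp
  then show ?case by (intro exI[of _ 0]) auto
next
  case (Suc t E)
  note E = Suc.prems(1-4)
  show ?case
  proof (cases "E = 0\<^sub>m n n")
    case True
    then show ?thesis by (intro exI[of _ 0]) auto
  next
    case False
    obtain w \<mu>0 where "eigenvector A w \<mu>0" and Ew: "E *\<^sub>v w = w"
      using eigenvector_in_range[OF A E(1-3) False E(4)] .
    then obtain c where ev: "eigenvector A (c \<cdot>\<^sub>v w) \<mu>0"
        and unit: "(\<Sum>i<n. (c \<cdot>\<^sub>v w) $ i * cnj ((c \<cdot>\<^sub>v w) $ i)) = 1"
      using unit_eigenvector[OF A(1)] by blast
    define v where "v = c \<cdot>\<^sub>v w"
    define R where "R = outer_prod v v"
    have v: "v \<in> carrier_vec n" and Av: "A *\<^sub>v v = \<mu>0 \<cdot>\<^sub>v v"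
      using ev A by (auto simp: eigenvector_def v_def)
    then have "w \<in> carrier_vec n" by (auto simp: v_def)
    then have Ev: "E *\<^sub>v v = v"
      unfolding v_def using E(1) Ew by (simp add: mult_mat_vec)
    have R: "R \<in> carrier_mat n n" "hermitian_mat R"
      using v by (auto simp: R_def hermitian_outer_prod)
    \<comment> \<open>Both products reduce to \<open>E *\<^sub>v v = v\<close>:
      \<open>E v v^* = v v^*\<close> and \<open>v v^* E = v (E v)^*\<close>.\<close>
    have ER: "E * R = R" and RE: "R * E = R"
      using E v Ev by (auto simp: R_def mult_outer_prod outer_prod_mult_hermitian)
    have "R *\<^sub>v v = v"
    proof (rule eq_vecI)
      fix i assume "i < dim_vec v"
      then have "(R *\<^sub>v v) $ i = v $ i * (\<Sum>j<n. v $ j * cnj (v $ j))"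
        using v by (auto simp: R_def outer_prod_def scalar_prod_def atLeast0LessThan sum_distrib_left
          mult_ac intro!: sum.cong)
      then show "(R *\<^sub>v v) $ i = v $ i" using unit by (simp add: v_def)
    qed (use v in \<open>auto simp: R_def outer_prod_def\<close>)
    then have RR: "R * R = R"
      using mult_outer_prod[OF R(1) v v] by (simp add: R_def)
    have trR: "mat_trace R = 1"
      using v unit unfolding v_def[symmetric] by (simp add: mat_trace_def R_def outer_prod_def)
    have AR_RA: "A * R = \<mu>0 \<cdot>\<^sub>m R" "R * A = cnj \<mu>0 \<cdot>\<^sub>m R"
    proof -
      have "outer_prod (\<mu>0 \<cdot>\<^sub>v v) v = \<mu>0 \<cdot>\<^sub>m R" "outer_prod v (\<mu>0 \<cdot>\<^sub>v v) = cnj \<mu>0 \<cdot>\<^sub>m R"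
        by (auto simp: R_def outer_prod_def mult_ac)
      then show "A * R = \<mu>0 \<cdot>\<^sub>m R" "R * A = cnj \<mu>0 \<cdot>\<^sub>m R"
        using mult_outer_prod[OF A(1) v v] outer_prod_mult_hermitian[OF A v v] by (simp_all add: Av R_def)
    qed
    have tr_smult: "mat_trace (c \<cdot>\<^sub>m R) = c" for c
      using trR R by (simp add: mat_trace_def flip: sum_distrib_left)
    \<comment> \<open>\<open>A * R\<close> and \<open>R * A\<close> have equal traces, and these are
      the eigenvalue and its conjugate. So the eigenvalue is real, which makes \<open>R\<close>
      commute with \<open>A\<close>.\<close>
    have "\<mu>0 = cnj \<mu>0"
      using mat_trace_mult_commute[OF A(1) R(1)] by (simp only: AR_RA tr_smult)
    then have AR: "A * R = R * A"
      using AR_RA by simp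
    \<comment> \<open>\<open>F\<close> projects onto the orthogonal complement of \<open>v\<close>
      in the range of \<open>E\<close>. It is again a Hermitian projection commuting with
      \<open>A\<close>, with trace smaller by one.\<close>
    define F where "F = E - R"
    have F: "F \<in> carrier_mat n n" "hermitian_mat F"
      using E R
      by (auto simp: F_def hermitian_mat_cnj_index[OF E(1,2)] hermitian_mat_cnj_index[OF R]
        intro!: hermitian_matI[of _ n])
    have "F * F = E * E - R * E - (E * R - R * R)"
      using E(1) R(1) F(1) mult_minus_distrib_mat[OF F(1) E(1) R(1)]
        minus_mult_distrib_mat[OF E(1) R(1) E(1)] minus_mult_distrib_mat[OF E(1) R(1) R(1)]
      by (simp add: F_def)
    then have FF: "F * F = F"
      using E R by (auto simp: E ER RE RR F_def)
    have AF: "A * F = F * A"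
      using mult_minus_distrib_mat[OF A(1) E(1) R(1)] minus_mult_distrib_mat[OF E(1) R(1) A(1)] E(4) AR
      by (simp add: F_def)
    have "mat_trace F = mat_trace E - mat_trace R"
      using E R by (simp add: F_def mat_trace_def sum_subtractf)
    then have "Re (mat_trace F) \<le> real t"
      using Suc.prems(5) trR by simp
    from Suc.IH[OF F FF AF this] obtain d u \<mu> where
        u: "\<forall>l<d. eigenvector A (u l) (\<mu> l)"
      and Fu: "\<forall>i<n. \<forall>j<n. F $$ (i, j) = (\<Sum>l<d::nat. u l $ i * cnj (u l $ j))"
      by blast
    have "\<forall>l<Suc d. eigenvector A ((u(d := v)) l) ((\<mu>(d := \<mu>0)) l)"
      using u ev by (auto simp: v_def less_Suc_eq)
    moreover have "E $$ (i, j) = (\<Sum>l<Suc d. (u(d := v)) l $ i * cnj ((u(d := v)) l $ j))"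
      if "i < n" "j < n" for i j
    proof -
      have "R $$ (i, j) = v $ i * cnj (v $ j)"
        using v that by (simp add: R_def)
      then have "E $$ (i, j) = F $$ (i, j) + v $ i * cnj (v $ j)"
        using E(1) R(1) that by (simp add: F_def)
      then show ?thesis using Fu that by simp
    qed
    ultimately show ?thesis by blast
  qed
qed

text \<open>The projection lemma for the identity, whose trace is \<open>n\<close>, writes the
  identity as the sum of the \<open>u_l u_l^*\<close>. Multiplying by the \<open>p\<close>-th power
  of \<open>A\<close> scales each term by \<open>\<mu> l ^ p\<close>.\<close>

lemma hermitian_mat_power_resolution:
  assumes A: "A \<in> carrier_mat n n" "hermitian_mat A"
  obtains d u \<mu> where "\<And>l. l < d \<Longrightarrow> eigenvector A (u l) (\<mu> l)"
    and "\<And>p. A ^\<^sub>m p = mat n n (\<lambda>(i, j). \<Sum>l<d::nat. \<mu> l ^ p * outer_prod (u l) (u l) $$ (i, j))"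
proof -
  have "hermitian_mat (1\<^sub>m n :: complex mat)"
    by (rule hermitian_matI[of _ n]) auto
  then obtain d u \<mu> where ev: "\<forall>l<d. eigenvector A (u l) (\<mu> l)"
    and I: "\<forall>i<n. \<forall>j<n. (1\<^sub>m n :: complex mat) $$ (i, j) = (\<Sum>l<d::nat. u l $ i * cnj (u l $ j))"
    using eigenvector_resolution_projection[OF A, of "1\<^sub>m n" n] A(1) by (auto simp: mat_trace_def)
  have uc: "u l \<in> carrier_vec n" if "l < d" for l
    using ev A that by (auto simp: eigenvector_def)
  have "A ^\<^sub>m p = mat n n (\<lambda>(i, j). \<Sum>l<d. \<mu> l ^ p * outer_prod (u l) (u l) $$ (i, j))" for p
  proof (rule eq_matI; clarsimp)
    fix i j assume ij: "i < n" "j < n"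
    have Ap: "A ^\<^sub>m p \<in> carrier_mat n n" using A by simp
    have "(A ^\<^sub>m p) $$ (i, j) = (A ^\<^sub>m p * 1\<^sub>m n) $$ (i, j)"
      by (simp only: right_mult_one_mat[OF Ap])
    also have "\<dots> = (\<Sum>a<n. (A ^\<^sub>m p) $$ (i, a) * (\<Sum>l<d. u l $ a * cnj (u l $ j)))"
      using I ij by (subst index_mult_mat_sum[OF Ap one_carrier_mat ij]) (auto intro!: sum.cong)
    also have "\<dots> = (\<Sum>l<d. (\<Sum>a<n. (A ^\<^sub>m p) $$ (i, a) * u l $ a) * cnj (u l $ j))"
      by (simp add: sum_distrib_left sum_distrib_right mult.assoc) (rule sum.swap)
    also have "\<dots> = (\<Sum>l<d. \<mu> l ^ p * outer_prod (u l) (u l) $$ (i, j))"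
    proof (intro sum.cong refl)
      fix l assume l: "l \<in> {..<d}"
      then have dim: "dim_vec (u l) = n" using uc by auto
      have "(\<Sum>a<n. (A ^\<^sub>m p) $$ (i, a) * u l $ a) = (A ^\<^sub>m p *\<^sub>v u l) $ i"
        using carrier_matD[OF Ap] ij dim by (simp add: scalar_prod_def atLeast0LessThan)
      also have "\<dots> = \<mu> l ^ p * u l $ i"
        using eigenvector_pow[OF A(1), of "u l" "\<mu> l" p] ev l ij dim by simp
      finally show "(\<Sum>a<n. (A ^\<^sub>m p) $$ (i, a) * u l $ a) * cnj (u l $ j) =
          \<mu> l ^ p * outer_prod (u l) (u l) $$ (i, j)"
        using ij dim by simp
    qed
    finally show "(A ^\<^sub>m p) $$ (i, j) = (\<Sum>l<d. \<mu> l ^ p * outer_prod (u l) (u l) $$ (i, j))" .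
  qed (use A in auto)
  then show ?thesis using ev that by blast
qed


section \<open>Positive maps and block matrices\<close>

text \<open>Sums are taken entry by entry, so that even the empty sum is a matrix of definite size;
  induction on \<open>d\<close> then uses additivity and homogeneity.\<close>

lemma linear_mat_map_sum:
  assumes lin: "linear_mat_map n k \<Phi>" and P: "\<And>l. l < d \<Longrightarrow> P l \<in> carrier_mat n n"
  shows "\<Phi> (mat n n (\<lambda>(i, j). \<Sum>l<d::nat. c l * P l $$ (i, j))) =
    mat k k (\<lambda>(i, j). \<Sum>l<d. c l * \<Phi> (P l) $$ (i, j))"
  using P
proof (induction d)
  have carr: "\<Phi> X \<in> carrier_mat k k" if "X \<in> carrier_mat n n" for X
    using lin that by (auto simp: linear_mat_map_def)
  case 0
  \<comment> \<open>Homogeneity with scalar 0 shows that \<Phi> maps the zero matrix to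
    zero.\<close>
  have "\<Phi> (0 \<cdot>\<^sub>m 0\<^sub>m n n) = 0 \<cdot>\<^sub>m \<Phi> (0\<^sub>m n n)"
    using lin unfolding linear_mat_map_def by (metis zero_carrier_mat)
  moreover have "0 \<cdot>\<^sub>m 0\<^sub>m n n = mat n n (\<lambda>(i, j). 0 :: complex)" by auto
  moreover have "0 \<cdot>\<^sub>m \<Phi> (0\<^sub>m n n) = mat k k (\<lambda>(i, j). 0)"
    using carr[of "0\<^sub>m n n"] by auto
  ultimately show ?case by (simp add: case_prod_unfold)
next
  case (Suc d)
  let ?S = "mat n n (\<lambda>(i, j). \<Sum>l<d. c l * P l $$ (i, j))"
  have P: "P d \<in> carrier_mat n n" using Suc.prems by simp
  have carr: "\<Phi> (P d) \<in> carrier_mat k k"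
    using lin P by (auto simp: linear_mat_map_def)
  have "mat n n (\<lambda>(i, j). \<Sum>l<Suc d. c l * P l $$ (i, j)) = ?S + c d \<cdot>\<^sub>m P d"
    using P by auto
  moreover have "\<Phi> (?S + c d \<cdot>\<^sub>m P d) = \<Phi> ?S + c d \<cdot>\<^sub>m \<Phi> (P d)"
    using lin P by (simp add: linear_mat_map_def)
  moreover have "\<Phi> ?S = mat k k (\<lambda>(i, j). \<Sum>l<d. c l * \<Phi> (P l) $$ (i, j))"
    by (rule Suc.IH) (simp add: Suc.prems)
  ultimately have "\<Phi> (mat n n (\<lambda>(i, j). \<Sum>l<Suc d. c l * P l $$ (i, j))) =
      mat k k (\<lambda>(i, j). \<Sum>l<d. c l * \<Phi> (P l) $$ (i, j)) + c d \<cdot>\<^sub>m \<Phi> (P d)"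
    by (simp only:)
  also have "\<dots> = mat k k (\<lambda>(i, j). \<Sum>l<Suc d. c l * \<Phi> (P l) $$ (i, j))"
    using carr by (intro eq_matI) auto
  finally show ?case .
qed

text \<open>With \<open>y l a = (\<Sum>i. t l ^ i * x (i * k + a))\<close>, the quadratic form of \<open>B\<close> at \<open>x\<close> is the
  sum over \<open>l\<close> of \<open>c l\<close> times the quadratic form of \<open>W l\<close> at \<open>y l\<close>.\<close>
lemma psd_weighted_moment_mat:
  fixes c t :: "nat \<Rightarrow> real"
  assumes B: "B \<in> carrier_mat (s * k) (s * k)"
    and W: "\<And>l. l < d \<Longrightarrow> W l \<in> carrier_mat k k" "\<And>l. l < d \<Longrightarrow> psd_mat (W l)"
    and c: "\<And>l. l < d \<Longrightarrow> 0 \<le> c l"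
    and entry: "\<And>p q. p < s * k \<Longrightarrow> q < s * k \<Longrightarrow> B $$ (p, q) =
      (\<Sum>l<d. complex_of_real (c l * t l ^ (p div k + q div k)) * W l $$ (p mod k, q mod k))"
  shows "psd_mat B"
\<comment> \<open>For \<open>k = 0\<close> the matrix is empty. This case is separate because
  \<open>p mod k\<close> lies below \<open>k\<close> only for positive \<open>k\<close>.\<close>
proof (cases "k = 0")
  case True
  then show ?thesis
    using B hermitian_matI[OF B] by (simp add: psd_mat_iff[OF B])
next
  case False
  let ?N = "s * k"
  have mod: "p mod k < k" for p using False by simp
  \<comment> \<open>The real weights are symmetric in \<open>p\<close> and \<open>q\<close>, so
    Hermitian symmetry is inherited from the \<open>W l\<close>.\<close>
  have "B $$ (p, q) = cnj (B $$ (q, p))" if "p < ?N" "q < ?N" for p q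
  proof -
    have "W l $$ (p mod k, q mod k) = cnj (W l $$ (q mod k, p mod k))" if "l < d" for l
      using W[OF that] mod hermitian_mat_cnj_index by (metis psd_mat_def)
    then show ?thesis
      using that by (simp add: entry add.commute)
  qed
  then have "hermitian_mat B" by (rule hermitian_matI[OF B])
  moreover have "0 \<le> Re (\<Sum>p<?N. \<Sum>q<?N. B $$ (p, q) * x q * cnj (x p))" for x :: "nat \<Rightarrow> complex"
  proof -
    define e where "e l q = complex_of_real (t l ^ (q div k)) * x q" for l q
    \<comment> \<open>The indices with residue \<open>a\<close> are \<open>i * k + a\<close>, one in
      each block.\<close>
    define y where "y l a = (\<Sum>q | q \<in> {..<?N} \<and> q mod k = a. e l q)" for l a
    \<comment> \<open>Grouping indices by residue collapses a sum over all \<open>s * k\<close>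
      positions to one over \<open>k\<close> coordinates. It is applied first to the column index,
      then to the row index.\<close>
    have fibre: "(\<Sum>q<?N. H (q mod k) * g q) = (\<Sum>a<k. H a * (\<Sum>q | q \<in> {..<?N} \<and> q mod k = a. g q))"
      for H g :: "nat \<Rightarrow> complex"
    proof -
      have "(\<Sum>q<?N. H (q mod k) * g q) =
          (\<Sum>a<k. \<Sum>q | q \<in> {..<?N} \<and> q mod k = a. H (q mod k) * g q)"
        using mod by (intro sum.group[symmetric]) auto
      also have "\<dots> = (\<Sum>a<k. H a * (\<Sum>q | q \<in> {..<?N} \<and> q mod k = a. g q))"
        unfolding sum_distrib_left by (intro sum.cong) auto
      finally show ?thesis .
    qed
    have form: "(\<Sum>p<?N. \<Sum>q<?N. W l $$ (p mod k, q mod k) * e l q * cnj (e l p)) =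
        (\<Sum>a<k. \<Sum>b<k. W l $$ (a, b) * y l b * cnj (y l a))" for l
    proof -
      define H where "H a = (\<Sum>q<?N. W l $$ (a, q mod k) * e l q)" for a
      have H: "H a = (\<Sum>b<k. W l $$ (a, b) * y l b)" for a
        unfolding H_def y_def by (rule fibre)
      have "(\<Sum>p<?N. \<Sum>q<?N. W l $$ (p mod k, q mod k) * e l q * cnj (e l p)) =
          (\<Sum>p<?N. H (p mod k) * cnj (e l p))"
        by (simp only: H_def sum_distrib_right)
      also have "\<dots> = (\<Sum>a<k. H a * cnj (y l a))"
        unfolding y_def cnj_sum by (rule fibre)
      finally show ?thesis by (simp only: H sum_distrib_right)
    qed
    \<comment> \<open>The power of \<open>t l\<close> splits into a row factor and a column factor,
      absorbed by \<open>e l p\<close> and \<open>e l q\<close>; conjugation leaves the row factor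
      alone since \<open>t l\<close> is real.\<close>
    have "(\<Sum>p<?N. \<Sum>q<?N. B $$ (p, q) * x q * cnj (x p)) =
        (\<Sum>p<?N. \<Sum>q<?N. \<Sum>l<d. complex_of_real (c l) * (W l $$ (p mod k, q mod k) * e l q * cnj (e l p)))"
      by (intro sum.cong refl) (simp add: entry e_def sum_distrib_left power_add mult_ac)
    also have "\<dots> =
        (\<Sum>p<?N. \<Sum>l<d. \<Sum>q<?N. complex_of_real (c l) * (W l $$ (p mod k, q mod k) * e l q * cnj (e l p)))"
      by (intro sum.cong refl sum.swap)
    also have "\<dots> =
        (\<Sum>l<d. \<Sum>p<?N. \<Sum>q<?N. complex_of_real (c l) * (W l $$ (p mod k, q mod k) * e l q * cnj (e l p)))"
      by (rule sum.swap)
    also have "\<dots> = (\<Sum>l<d. complex_of_real (c l) * (\<Sum>a<k. \<Sum>b<k. W l $$ (a, b) * y l b * cnj (y l a)))"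
      by (simp only: form sum_distrib_left[symmetric])
    finally have "Re (\<Sum>p<?N. \<Sum>q<?N. B $$ (p, q) * x q * cnj (x p)) =
        (\<Sum>l<d. c l * Re (\<Sum>a<k. \<Sum>b<k. W l $$ (a, b) * y l b * cnj (y l a)))"
      by simp
    also have "\<dots> \<ge> 0"
      using c W psd_mat_iff by (intro sum_nonneg mult_nonneg_nonneg) blast+
    finally show ?thesis .
  qed
  ultimately show ?thesis by (simp add: psd_mat_iff[OF B])
qed

section \<open>Positivity of the two moment block matrices\<close>

theorem theorem2p1:
  fixes n k r :: nat and m M :: real
    and \<Phi> :: "complex mat \<Rightarrow> complex mat" and A :: "complex mat"
  assumes "linear_mat_map n k \<Phi>"
    and "positive_mat_map n \<Phi>"
    and "unital_mat_map n k \<Phi>"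
    and "A \<in> carrier_mat n n"
    and "hermitian_mat A"
    and "spectrum A \<subseteq> complex_of_real ` {m..M}"
  shows "psd_mat (block_mat (r + 1) k (\<lambda>i j.
           \<Phi> (A ^\<^sub>m (i + j - 1)) - complex_of_real m \<cdot>\<^sub>m \<Phi> (A ^\<^sub>m (i + j - 2))))
       \<and> psd_mat (block_mat (r + 1) k (\<lambda>i j.
           complex_of_real M \<cdot>\<^sub>m \<Phi> (A ^\<^sub>m (i + j - 2)) - \<Phi> (A ^\<^sub>m (i + j - 1))))"
proof -
  obtain d u \<mu> where ev: "\<And>l. l < d \<Longrightarrow> eigenvector A (u l) (\<mu> l)"
    and pow: "\<And>p. A ^\<^sub>m p = mat n n (\<lambda>(i, j). \<Sum>l<d::nat. \<mu> l ^ p * outer_prod (u l) (u l) $$ (i, j))"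
    using hermitian_mat_power_resolution[OF assms(4,5)] by blast
  define t where "t l = Re (\<mu> l)" for l
  define W where "W l = \<Phi> (outer_prod (u l) (u l))" for l
  \<comment> \<open>The spectrum lies in a real interval, so passing to real parts loses nothing and
    both weights \<open>t l - m\<close> and \<open>M - t l\<close> are nonnegative.\<close>
  have t: "\<mu> l = complex_of_real (t l)" "m \<le> t l" "t l \<le> M" if "l < d" for l
  proof -
    have "\<mu> l \<in> spectrum A"
      using ev[OF that] by (auto simp: spectrum_def eigenvalue_def)
    then show "\<mu> l = complex_of_real (t l)" "m \<le> t l" "t l \<le> M"
      using assms(6) by (auto simp: t_def)
  qed
  have P: "outer_prod (u l) (u l) \<in> carrier_mat n n" if "l < d" for l
    using ev[OF that] assms(4) by (auto simp: eigenvector_def)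
  have W: "W l \<in> carrier_mat k k" "psd_mat (W l)" if "l < d" for l
    using assms(1,2) P[OF that] psd_outer_prod
    by (auto simp: W_def linear_mat_map_def positive_mat_map_def)
  have \<Phi>pow: "\<Phi> (A ^\<^sub>m p) = mat k k (\<lambda>(i, j). \<Sum>l<d. complex_of_real (t l ^ p) * W l $$ (i, j))" for p
  proof -
    have "\<Phi> (A ^\<^sub>m p) = mat k k (\<lambda>(i, j). \<Sum>l<d. \<mu> l ^ p * W l $$ (i, j))"
      unfolding pow W_def by (rule linear_mat_map_sum[OF assms(1) P])
    also have "\<dots> = mat k k (\<lambda>(i, j). \<Sum>l<d. complex_of_real (t l ^ p) * W l $$ (i, j))"
      using t(1) by (intro cong_mat refl) (auto intro!: sum.cong)
    finally show ?thesis .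
  qed
  have mod: "p mod k < k" if "p < (r + 1) * k" for p
    using that by (cases "k = 0") auto
  show ?thesis
  proof
    show "psd_mat (block_mat (r + 1) k (\<lambda>i j.
           \<Phi> (A ^\<^sub>m (i + j - 1)) - complex_of_real m \<cdot>\<^sub>m \<Phi> (A ^\<^sub>m (i + j - 2))))" (is "psd_mat ?B")
    \<comment> \<open>Blocks are numbered from 1, so \<open>i + j - 2\<close> equals
      \<open>p div k + q div k\<close> and \<open>i + j - 1\<close> is one more; truncated
      subtraction does no harm. The extra factor \<open>t l\<close> combines with \<open>m\<close>
      into the weight \<open>t l - m\<close>.\<close>
    proof (rule psd_weighted_moment_mat[where W = W and c = "\<lambda>l. t l - m" and t = t and d = d])
      fix p q assume pq: "p < (r + 1) * k" "q < (r + 1) * k"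
      then show "?B $$ (p, q) = (\<Sum>l<d. complex_of_real ((t l - m) * t l ^ (p div k + q div k)) *
          W l $$ (p mod k, q mod k))"
        using mod[OF pq(1)] mod[OF pq(2)]
        by (simp add: block_mat_def \<Phi>pow sum_distrib_left algebra_simps flip: sum_subtractf)
    qed (use W t in \<open>auto simp: block_mat_def\<close>)
    show "psd_mat (block_mat (r + 1) k (\<lambda>i j.
           complex_of_real M \<cdot>\<^sub>m \<Phi> (A ^\<^sub>m (i + j - 2)) - \<Phi> (A ^\<^sub>m (i + j - 1))))" (is "psd_mat ?B")
    \<comment> \<open>The same exponents occur, now with the terms in the opposite order, which
      gives the weight \<open>M - t l\<close>.\<close>
    proof (rule psd_weighted_moment_mat[where W = W and c = "\<lambda>l. M - t l" and t = t and d = d])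
      fix p q assume pq: "p < (r + 1) * k" "q < (r + 1) * k"
      then show "?B $$ (p, q) = (\<Sum>l<d. complex_of_real ((M - t l) * t l ^ (p div k + q div k)) *
          W l $$ (p mod k, q mod k))"
        using mod[OF pq(1)] mod[OF pq(2)]
        by (simp add: block_mat_def \<Phi>pow sum_distrib_left algebra_simps flip: sum_subtractf)
    qed (use W t in \<open>auto simp: block_mat_def\<close>)
  qed
qed

end
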